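(* For every network $N$ the following are equivalent: (1) $N$ has the global lca-property; (2) $\mathfrak{D}_N$ is closed; (3) $\mathfrak{A}_N$ is closed; (4) $\mathfrak{B}_N$ is closed.
   Context: A DAG is a finite directed graph without loops and directed cycles; $u\preceq_G v$ means there is a directed path from $v$ to $u$ (including $u=v$). A network is a DAG with exactly one $\preceq_G$-maximal vertex. For non-empty $A\subseteq V(G)$, $\mathrm{LCA}_G(A)$ is the set of $\preceq_G$-minimal vertices $v$ with $a\preceq_G v$ for all $a\in A$; $G$ has the global lca-property if $|\mathrm{LCA}_G(A)|=1$ for all non-empty $A\subseteq V(G)$. For $v\in V(G)$ let $D_G(v)=\{u: u\preceq_G v\}$ and $\mathrm{ANC}_G(v)=\{u: v\preceq_G u\}$. Put $\mathfrak{D}_G=\{D_G(v): v\in V(G)\}$, $\mathfrak{A}_G=\{\mathrm{ANC}_G(v): v\in V(G)\}$, and $\mathfrak{B}_G=\{B_G(u,v): u,v\in V(G)\}$ where $B_G(u,v)=D_G(u)\cap\mathrm{ANC}_G(v)$. A set system $\mathfrak{C}$ is closed if $A,B\in\mathfrak{C}$ implies $A\cap B\in\mathfrak{C}$ or $A\cap B=\emptyset$. *)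

theory Defs
  imports "Graph_Theory.Arc_Walk"
begin

(* The locale digraph bundles: finitely many vertices and arcs, no loops, no parallel arcs. *)
locale dag = digraph +
  assumes no_cycles: "\<not> (\<exists>p. cycle p)"

(* Arcs point downwards: u lies below v if there is a directed path from v to u.
   apath allows the empty path at a vertex, so this is reflexive on verts G. *)
definition below :: "('a, 'b) pre_digraph \<Rightarrow> 'a \<Rightarrow> 'a \<Rightarrow> bool"
    (\<open>_ \<preceq>\<index> _\<close> [51, 51] 50) where
  "below G u v \<longleftrightarrow> (\<exists>p. pre_digraph.apath G v p u)"

lemma (in wf_digraph) below_iff_reachable: "u \<preceq> v \<longleftrightarrow> v \<rightarrow>\<^sup>* u"
  unfolding below_def reachable_awalk
  using apath_awalk_to_apath awalkI_apath by blast

definition maximal_vertex :: "('a, 'b) pre_digraph \<Rightarrow> 'a \<Rightarrow> bool" where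
  "maximal_vertex G v \<longleftrightarrow> v \<in> verts G \<and> (\<forall>w \<in> verts G. v \<preceq>\<^bsub>G\<^esub> w \<longrightarrow> w = v)"

locale network = dag +
  assumes unique_maximal: "\<exists>!v. maximal_vertex G v"

definition common_ancestors :: "('a, 'b) pre_digraph \<Rightarrow> 'a set \<Rightarrow> 'a set" where
  "common_ancestors G A = {v \<in> verts G. \<forall>a \<in> A. a \<preceq>\<^bsub>G\<^esub> v}"

definition LCA :: "('a, 'b) pre_digraph \<Rightarrow> 'a set \<Rightarrow> 'a set" where
  "LCA G A = {v \<in> common_ancestors G A. \<forall>w \<in> common_ancestors G A. w \<preceq>\<^bsub>G\<^esub> v \<longrightarrow> w = v}"

definition global_lca_property :: "('a, 'b) pre_digraph \<Rightarrow> bool" where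
  "global_lca_property G \<longleftrightarrow> (\<forall>A. A \<subseteq> verts G \<and> A \<noteq> {} \<longrightarrow> card (LCA G A) = 1)"

definition descendants :: "('a, 'b) pre_digraph \<Rightarrow> 'a \<Rightarrow> 'a set" where
  "descendants G v = {u \<in> verts G. u \<preceq>\<^bsub>G\<^esub> v}"

definition ancestors :: "('a, 'b) pre_digraph \<Rightarrow> 'a \<Rightarrow> 'a set" where
  "ancestors G v = {u \<in> verts G. v \<preceq>\<^bsub>G\<^esub> u}"

definition between :: "('a, 'b) pre_digraph \<Rightarrow> 'a \<Rightarrow> 'a \<Rightarrow> 'a set" where
  "between G u v = descendants G u \<inter> ancestors G v"

definition descendant_system :: "('a, 'b) pre_digraph \<Rightarrow> 'a set set" where
  "descendant_system G = {descendants G v | v. v \<in> verts G}"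

definition ancestor_system :: "('a, 'b) pre_digraph \<Rightarrow> 'a set set" where
  "ancestor_system G = {ancestors G v | v. v \<in> verts G}"

(* The empty set is a member whenever some pair u, v has no directed path from u to v. *)
definition between_system :: "('a, 'b) pre_digraph \<Rightarrow> 'a set set" where
  "between_system G = {between G u v | u v. u \<in> verts G \<and> v \<in> verts G}"

definition closed_system :: "'a set set \<Rightarrow> bool" where
  "closed_system C \<longleftrightarrow> (\<forall>A \<in> C. \<forall>B \<in> C. A \<inter> B \<in> C \<or> A \<inter> B = {})"

end

(* In a finite poset with a top element, the global lca-property says that every non-empty set A
   has a least upper bound m, i.e. that the common ancestors of A are exactly the ancestors of m.
   For pairs this is closedness of the ancestor system, whose members all contain the root and so
   meet; finite intersections recover all of A.  Closedness of the descendant system is linked to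
   joins by the usual duality: the join of A is the meet of its upper bounds. *)
theory Submission
  imports Defs
begin

text \<open>Non-emptiness of the full intersection passes to every partial one, so the disjointness
  alternative in \<open>closed_system\<close> never applies during the induction.\<close>

lemma closed_system_Inter:
  assumes "closed_system C" "finite F" "F \<noteq> {}" "F \<subseteq> C" "\<Inter>F \<noteq> {}"
  shows "\<Inter>F \<in> C"
  using assms(2-)
proof (induction F rule: finite_ne_induct)
  case (insert X F)
  have "\<Inter>F \<in> C"
    using insert by auto
  then show ?case
    using insert.prems assms(1) unfolding closed_system_def by auto
qed simp

section \<open>Reachability as a finite partial order; least common ancestors\<close>

context dag
begin

lemma below_refl: "v \<in> verts G \<Longrightarrow> v \<preceq> v"
  by (simp add: below_iff_reachable)

lemma below_trans: "u \<preceq> v \<Longrightarrow> v \<preceq> w \<Longrightarrow> u \<preceq> w"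
  unfolding below_iff_reachable by (rule reachable_trans)

text \<open>Walks both ways between distinct vertices concatenate to a non-empty closed walk, which
  yields a cycle.\<close>

lemma below_antisym:
  assumes "u \<preceq> v" "v \<preceq> u"
  shows "u = v"
proof (rule ccontr)
  assume "u \<noteq> v"
  obtain p q where p: "awalk v p u" and q: "awalk u q v"
    using assms unfolding below_iff_reachable reachable_awalk by blast
  have "p \<noteq> []"
    using p \<open>u \<noteq> v\<close> by (auto simp: awalk_Nil_iff)
  then have "closed_w (p @ q)"
    using awalk_appendI[OF p q] unfolding closed_w_def by auto
  then show False
    using closed_w_imp_cycle no_cycles by blast
qed

lemma exists_minimal_below:
  assumes "S \<subseteq> verts G" "x \<in> S"
  shows "\<exists>m\<in>S. m \<preceq> x \<and> (\<forall>w\<in>S. w \<preceq> m \<longrightarrow> w = m)"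
proof -
  \<comment> \<open>Cutting \<open>S\<close> down to the elements below \<open>x\<close> puts the
    minimal element below \<open>x\<close>; by transitivity it is still minimal in \<open>S\<close>.
    \<open>?R\<close> is the strict order, since \<open>bex_min_element\<close> asks for
    asymmetry.\<close>
  let ?T = "{y \<in> S. y \<preceq> x}" and ?R = "\<lambda>a b. a \<preceq> b \<and> a \<noteq> b"
  have "finite ?T" "?T \<noteq> {}"
    using assms finite_subset[OF _ finite_verts] below_refl by auto
  moreover have "asymp_on ?T ?R" "transp_on ?T ?R"
    by (auto intro!: transp_onI dest: below_antisym intro: below_trans)
  ultimately obtain m where "m \<in> ?T" "\<forall>y\<in>?T. y \<noteq> m \<longrightarrow> \<not> ?R y m"
    using Finite_Set.bex_min_element[of ?T ?R] by blast
  then show ?thesis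
    using below_trans by blast
qed

lemma exists_maximal_above:
  assumes "x \<in> verts G"
  shows "\<exists>m. maximal_vertex G m \<and> x \<preceq> m"
proof -
  let ?T = "{y \<in> verts G. x \<preceq> y}" and ?R = "\<lambda>a b. a \<preceq> b \<and> a \<noteq> b"
  have "finite ?T" "?T \<noteq> {}"
    using assms below_refl by auto
  moreover have "asymp_on ?T ?R" "transp_on ?T ?R"
    by (auto intro!: transp_onI dest: below_antisym intro: below_trans)
  ultimately obtain m where "m \<in> ?T" "\<forall>y\<in>?T. y \<noteq> m \<longrightarrow> \<not> ?R m y"
    using Finite_Set.bex_max_element[of ?T ?R] by blast
  then show ?thesis
    using below_trans unfolding maximal_vertex_def by blast
qed

lemma common_ancestors_eq_Inter:
  assumes "A \<noteq> {}"
  shows "common_ancestors G A = (\<Inter>a\<in>A. ancestors G a)"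
  using assms unfolding common_ancestors_def ancestors_def by blast

text \<open>The common ancestors form an up-set, so being generated by \<open>m\<close> amounts to
  having \<open>m\<close> as least element.\<close>

lemma common_ancestors_eq_ancestors_iff:
  assumes "m \<in> verts G"
  shows "common_ancestors G A = ancestors G m \<longleftrightarrow>
    m \<in> common_ancestors G A \<and> (\<forall>w \<in> common_ancestors G A. m \<preceq> w)"
  using assms below_refl below_trans unfolding common_ancestors_def ancestors_def by blast

text \<open>In a finite order a unique minimal element is already the least one. This turns the
  lca-property into membership in \<open>ancestor_system\<close>.\<close>

lemma LCA_eq_singleton_iff:
  "LCA G A = {m} \<longleftrightarrow> m \<in> verts G \<and> common_ancestors G A = ancestors G m"
proof
  assume L: "LCA G A = {m}"
  then have m: "m \<in> common_ancestors G A"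
    unfolding LCA_def by blast
  have "m \<preceq> w" if w: "w \<in> common_ancestors G A" for w
  proof -
    have "common_ancestors G A \<subseteq> verts G"
      unfolding common_ancestors_def by blast
    \<comment> \<open>Some minimal common ancestor lies below \<open>w\<close>; by uniqueness it is
      \<open>m\<close>.\<close>
    then obtain k where "k \<in> common_ancestors G A" "k \<preceq> w"
      "\<forall>x\<in>common_ancestors G A. x \<preceq> k \<longrightarrow> x = k"
      using exists_minimal_below[OF _ w] by blast
    then have "k \<in> LCA G A"
      unfolding LCA_def by blast
    with L \<open>k \<preceq> w\<close> show ?thesis by simp
  qed
  moreover have "m \<in> verts G"
    using m unfolding common_ancestors_def by blast
  ultimately show "m \<in> verts G \<and> common_ancestors G A = ancestors G m"
    using m common_ancestors_eq_ancestors_iff[of m A] by blast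
next
  assume "m \<in> verts G \<and> common_ancestors G A = ancestors G m"
  then show "LCA G A = {m}"
    using common_ancestors_eq_ancestors_iff[of m A] below_antisym unfolding LCA_def by blast
qed

lemma global_lca_property_iff:
  "global_lca_property G \<longleftrightarrow>
    (\<forall>A. A \<subseteq> verts G \<and> A \<noteq> {} \<longrightarrow> common_ancestors G A \<in> ancestor_system G)"
  unfolding global_lca_property_def One_nat_def card_1_singleton_iff
    LCA_eq_singleton_iff ancestor_system_def
  by (simp add: conj_commute)

text \<open>The lca \<open>m\<close> of the intersection \<open>S\<close> is its greatest element:
  \<open>u\<close> and \<open>v\<close> bound \<open>S\<close> from above, so \<open>m\<close> lies
  below both and hence in \<open>S\<close>.\<close>

lemma global_lca_imp_closed_descendants:
  assumes "global_lca_property G"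
  shows "closed_system (descendant_system G)"
proof -
  have "descendants G u \<inter> descendants G v \<in> descendant_system G"
    if uv: "u \<in> verts G" "v \<in> verts G" and ne: "descendants G u \<inter> descendants G v \<noteq> {}" for u v
  proof -
    define S where "S = descendants G u \<inter> descendants G v"
    have "S \<subseteq> verts G" "S \<noteq> {}"
      using ne unfolding S_def descendants_def by auto
    then obtain m where m: "m \<in> verts G" "common_ancestors G S = ancestors G m"
      using assms unfolding global_lca_property_iff ancestor_system_def by blast
    have "u \<in> common_ancestors G S" "v \<in> common_ancestors G S"
      using uv unfolding S_def common_ancestors_def descendants_def by auto
    then have "m \<preceq> u" "m \<preceq> v"
      using m unfolding ancestors_def by auto
    moreover have "\<forall>s\<in>S. s \<preceq> m"
      using m below_refl unfolding common_ancestors_def ancestors_def by blast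
    ultimately have "S = descendants G m"
      using below_trans unfolding S_def descendants_def by blast
    then show ?thesis
      using m(1) unfolding S_def descendant_system_def by blast
  qed
  then show ?thesis
    unfolding closed_system_def descendant_system_def by blast
qed

end

section \<open>Equivalences in the presence of a root\<close>

context network
begin

text \<open>Each vertex lies below some maximal vertex, and there is only one of those.\<close>

lemma exists_root: "\<exists>r\<in>verts G. \<forall>v\<in>verts G. v \<preceq> r"
proof -
  obtain r where r: "maximal_vertex G r" "\<forall>s. maximal_vertex G s \<longrightarrow> s = r"
    using unique_maximal by blast
  then have "\<forall>v\<in>verts G. v \<preceq> r"
    using exists_maximal_above by blast
  with r(1) show ?thesis
    unfolding maximal_vertex_def by blast
qed

lemma common_ancestors_nonempty:
  assumes "A \<subseteq> verts G"
  shows "common_ancestors G A \<noteq> {}"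
  using exists_root assms unfolding common_ancestors_def by blast

text \<open>Intersecting the descendant sets of all common ancestors of \<open>A\<close> gives
  \<open>descendants G m\<close> for some \<open>m\<close>, the meet of these ancestors. As the
  intersection contains \<open>A\<close>, this \<open>m\<close> is itself a common ancestor, hence
  the least.\<close>

lemma closed_descendants_imp_global_lca:
  assumes "closed_system (descendant_system G)"
  shows "global_lca_property G"
  unfolding global_lca_property_iff
proof (intro allI impI, elim conjE)
  fix A
  assume A: "A \<subseteq> verts G" "A \<noteq> {}"
  let ?U = "common_ancestors G A"
  have U: "?U \<subseteq> verts G" "?U \<noteq> {}"
    using common_ancestors_nonempty[OF A(1)] unfolding common_ancestors_def by auto
  have AU: "A \<subseteq> (\<Inter>w\<in>?U. descendants G w)"
    using A(1) unfolding common_ancestors_def descendants_def by blast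
  have "(\<Inter>w\<in>?U. descendants G w) \<in> descendant_system G"
  proof (rule closed_system_Inter[OF assms])
    show "finite (descendants G ` ?U)"
      using finite_subset[OF U(1) finite_verts] by simp
    show "descendants G ` ?U \<subseteq> descendant_system G"
      using U(1) unfolding descendant_system_def by blast
  qed (use U AU A in auto)
  then obtain m where m: "m \<in> verts G" "(\<Inter>w\<in>?U. descendants G w) = descendants G m"
    unfolding descendant_system_def by blast
  have "m \<in> ?U"
    using AU m unfolding common_ancestors_def descendants_def by auto
  moreover have "\<forall>w\<in>?U. m \<preceq> w"
    using m below_refl unfolding descendants_def by blast
  ultimately show "?U \<in> ancestor_system G"
    using m(1) common_ancestors_eq_ancestors_iff[of m A] unfolding ancestor_system_def by blast
qed

lemma global_lca_iff_closed_ancestors: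
  "global_lca_property G \<longleftrightarrow> closed_system (ancestor_system G)"
proof
  assume L: "global_lca_property G"
  have "ancestors G u \<inter> ancestors G v \<in> ancestor_system G"
    if "u \<in> verts G" "v \<in> verts G" for u v
  proof -
    have "common_ancestors G {u, v} \<in> ancestor_system G"
      using L[unfolded global_lca_property_iff, rule_format, of "{u, v}"] that by simp
    then show ?thesis
      by (simp add: common_ancestors_eq_Inter)
  qed
  then show "closed_system (ancestor_system G)"
    unfolding closed_system_def ancestor_system_def by blast
next
  assume C: "closed_system (ancestor_system G)"
  show "global_lca_property G"
    unfolding global_lca_property_iff
  proof (intro allI impI, elim conjE)
    fix A
    assume A: "A \<subseteq> verts G" "A \<noteq> {}"
    show "common_ancestors G A \<in> ancestor_system G"
      unfolding common_ancestors_eq_Inter[OF A(2)]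
    proof (rule closed_system_Inter[OF C])
      show "finite (ancestors G ` A)"
        using finite_subset[OF A(1) finite_verts] by simp
      show "ancestors G ` A \<subseteq> ancestor_system G"
        using A(1) unfolding ancestor_system_def by blast
      \<comment> \<open>The root belongs to every ancestor set.\<close>
      show "(\<Inter>a\<in>A. ancestors G a) \<noteq> {}"
        using common_ancestors_nonempty[OF A(1)] common_ancestors_eq_Inter[OF A(2)] by simp
    qed (use A in simp)
  qed
qed

text \<open>Intersecting two intervals intersects their descendant parts and their ancestor parts
  separately; if the result is non-empty, so are both parts.\<close>

lemma closed_descendants_ancestors_imp_closed_between:
  assumes D: "closed_system (descendant_system G)" and A: "closed_system (ancestor_system G)"
  shows "closed_system (between_system G)"
proof -
  have "between G u v \<inter> between G x y \<in> between_system G"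
    if V: "u \<in> verts G" "v \<in> verts G" "x \<in> verts G" "y \<in> verts G"
      and ne: "between G u v \<inter> between G x y \<noteq> {}" for u v x y
  proof -
    have "descendants G u \<inter> descendants G x \<in> descendant_system G"
      using D V ne unfolding closed_system_def descendant_system_def between_def by blast
    moreover have "ancestors G v \<inter> ancestors G y \<in> ancestor_system G"
      using A V ne unfolding closed_system_def ancestor_system_def between_def by blast
    ultimately obtain d a where da: "d \<in> verts G" "a \<in> verts G"
      "descendants G u \<inter> descendants G x = descendants G d"
      "ancestors G v \<inter> ancestors G y = ancestors G a"
      unfolding descendant_system_def ancestor_system_def by blast
    then have "between G u v \<inter> between G x y = between G d a"
      unfolding between_def by blast
    with da(1,2) show ?thesis
      unfolding between_system_def by blast
  qed
  then show ?thesis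
    unfolding closed_system_def between_system_def by blast
qed

text \<open>Ancestor sets are exactly the intervals whose upper end is the root \<open>r\<close>.
  Two of them meet in \<open>r\<close>, and an interval containing \<open>r\<close> must have
  \<open>r\<close> as its upper end.\<close>

lemma closed_between_imp_closed_ancestors:
  assumes "closed_system (between_system G)"
  shows "closed_system (ancestor_system G)"
proof -
  obtain r where r: "r \<in> verts G" "\<forall>v\<in>verts G. v \<preceq> r"
    using exists_root by blast
  have from_root: "between G r v = ancestors G v" for v
    using r(2) unfolding between_def descendants_def ancestors_def by blast
  have "ancestors G u \<inter> ancestors G v \<in> ancestor_system G"
    if uv: "u \<in> verts G" "v \<in> verts G" for u v
  proof -
    have root: "r \<in> ancestors G u \<inter> ancestors G v"
      using r uv unfolding ancestors_def by simp
    have "ancestors G u \<in> between_system G" "ancestors G v \<in> between_system G"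
      using from_root r(1) uv unfolding between_system_def by blast+
    then have "ancestors G u \<inter> ancestors G v \<in> between_system G"
      using assms root unfolding closed_system_def by blast
    then obtain x y where xy: "x \<in> verts G" "y \<in> verts G"
      "ancestors G u \<inter> ancestors G v = between G x y"
      unfolding between_system_def by blast
    then have "r \<preceq> x"
      using root unfolding between_def descendants_def by blast
    then have "x = r"
      using r(2) xy(1) below_antisym by blast
    then show ?thesis
      using xy from_root unfolding ancestor_system_def by blast
  qed
  then show ?thesis
    unfolding closed_system_def ancestor_system_def by blast
qed

end

theorem theorem7p8:
  fixes N :: "('a, 'b) pre_digraph"
  assumes "network N"
  shows "(global_lca_property N \<longleftrightarrow> closed_system (descendant_system N)) \<and>
         (closed_system (descendant_system N) \<longleftrightarrow> closed_system (ancestor_system N)) \<and>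
         (closed_system (ancestor_system N) \<longleftrightarrow> closed_system (between_system N))"
proof -
  interpret network N by fact
  show ?thesis
    \<comment> \<open>The lca-property is equivalent to closedness of the descendant system and of
      the ancestor system; these two together give the interval system, which gives back the
      ancestor system.\<close>
    using global_lca_imp_closed_descendants closed_descendants_imp_global_lca
      global_lca_iff_closed_ancestors closed_descendants_ancestors_imp_closed_between
      closed_between_imp_closed_ancestors
    by blast
qed

end
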